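(* Assume that $$\sigma:=2\min\{s_1,\dots,s_m\}-1>0.$$ Let $f:\mathbb{R}^n\to\mathbb{R}$ and let $u:\mathbb{R}^n\to\mathbb{R}$ be a solution of $Lu=f$ in the whole of $\mathbb{R}^n$. Assume that $f$ does not depend on the $n$th coordinate and that $$\lim_{R\to+\infty}\frac{\|u\|_{L^\infty(B_R)}}{R^\sigma}=0.$$ Then $u$ does not depend on the $n$th coordinate.
   Context: Setting. $\{e_1,\dots,e_n\}$ is the Euclidean basis of $\mathbb{R}^n$ and $B_r$ is the open ball of $\mathbb{R}^n$ centered at the origin with radius $r$. Let $m\in\mathbb{N}$ and $N_1,\dots,N_{m-1}\in\mathbb{N}$ (positive integers) with $N_1+\dots+N_{m-1}=n-1$, and set $N_m:=1$. Put $N_i':=N_1+\dots+N_i$ and $N_0':=0$. The coordinates of $x=(x_1,\dots,x_n)\in\mathbb{R}^n$ are split into groups $X_i:=(x_{N_{i-1}'+1},\dots,x_{N_i'})\in\mathbb{R}^{N_i}$ for $i\in\{1,\dots,m-1\}$, and $X_m:=x_n$. For $y=(y_1,\dots,y_{N_i})\in\mathbb{R}^{N_i}$ let $y^{(i)}:=y_1e_{N_{i-1}'+1}+\dots+y_{N_i}e_{N_i'}\in\mathbb{R}^n$. For $s_i\in(0,1]$, define: if $s_i=1$, $(-\Delta_{X_i})^{s_i}u(x):=-\partial^2_{x_{N_{i-1}'+1}}u(x)-\dots-\partial^2_{x_{N_i'}}u(x)$; if $s_i\in(0,1)$, $$(-\Delta_{X_i})^{s_i}u(x):=c_{N_i,s_i}\int_{\mathbb{R}^{N_i}}\frac{2u(x)-u(x+y^{(i)})-u(x-y^{(i)})}{|y^{(i)}|^{N_i+2s_i}}\,dy,\qquad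 c_{N,s}:=\frac{2^{2s-1}\,\Gamma(s+\frac N2)}{\pi^{N/2}\,|\Gamma(-s)|}.$$ Given $a_1,\dots,a_{m-1}\ge0$, $a>0$ and $s_1,\dots,s_{m-1}\in(0,1]$, set $a_m:=a$, $s_m:=1$ and $$L:=\sum_{i=1}^{m-1}a_i(-\Delta_{X_i})^{s_i}-a\,\partial^2_{x_n}=\sum_{i=1}^m a_i(-\Delta_{X_i})^{s_i}.$$ Solutions are classical: "$u:\mathbb{R}^n\to\mathbb{R}$ is a solution of $Lu=f$ in $\Omega$" means that $u$ is continuous and smooth enough for $Lu(x)$ to be computed pointwise at every $x\in\Omega$, and $Lu(x)=f(x)$ there. *)

theory Defs
  imports "HOL-Analysis.Analysis" "HOL-Probability.Essential_Supremum"
begin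

text \<open>
  Throughout, \<open>e 1, ..., e n\<close> is an enumeration of the Euclidean basis of \<open>\<real>\<^sup>n\<close>, and
  \<open>N 1, ..., N m\<close> are the sizes of consecutive blocks of coordinates. The space \<open>\<real>\<^sup>d\<close> of a block,
  whose dimension \<open>d = N i\<close> varies with \<open>i\<close>, is the set of functions on \<open>{1..d}\<close>
  with the product Lebesgue measure \<open>Pi\<^sub>M {1..d} (\<lambda>_. lborel)\<close>.
\<close>

definition block_end :: "(nat \<Rightarrow> nat) \<Rightarrow> nat \<Rightarrow> nat" where
  "block_end N i = (\<Sum>k=1..i. N k)"

definition block_vec :: "(nat \<Rightarrow> real ^ 'n) \<Rightarrow> (nat \<Rightarrow> nat) \<Rightarrow> nat \<Rightarrow> (nat \<Rightarrow> real) \<Rightarrow> real ^ 'n" where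
  "block_vec e N i y = (\<Sum>j=1..N i. y j *\<^sub>R e (block_end N (i - 1) + j))"

definition has_partial :: "real ^ 'n \<Rightarrow> (real ^ 'n \<Rightarrow> real) \<Rightarrow> real ^ 'n \<Rightarrow> bool" where
  "has_partial v u x \<longleftrightarrow> (\<lambda>t. u (x + t *\<^sub>R v)) field_differentiable (at 0)"

definition partial :: "real ^ 'n \<Rightarrow> (real ^ 'n \<Rightarrow> real) \<Rightarrow> real ^ 'n \<Rightarrow> real" where
  "partial v u x = deriv (\<lambda>t. u (x + t *\<^sub>R v)) 0"

definition has_partial2 :: "real ^ 'n \<Rightarrow> (real ^ 'n \<Rightarrow> real) \<Rightarrow> real ^ 'n \<Rightarrow> bool" where
  "has_partial2 v u x \<longleftrightarrow>
     (\<forall>\<^sub>F t in nhds 0. has_partial v u (x + t *\<^sub>R v)) \<and> has_partial v (partial v u) x"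

definition frac_const :: "nat \<Rightarrow> real \<Rightarrow> real" where
  "frac_const d s =
     2 powr (2 * s - 1) * Gamma (s + real d / 2) / (pi powr (real d / 2) * \<bar>Gamma (- s)\<bar>)"

definition frac_integrand ::
    "(nat \<Rightarrow> real ^ 'n) \<Rightarrow> (nat \<Rightarrow> nat) \<Rightarrow> nat \<Rightarrow> real \<Rightarrow> (real ^ 'n \<Rightarrow> real) \<Rightarrow> real ^ 'n \<Rightarrow> (nat \<Rightarrow> real) \<Rightarrow> real" where
  "frac_integrand e N i s u x y =
     (2 * u x - u (x + block_vec e N i y) - u (x - block_vec e N i y))
       / norm (block_vec e N i y) powr (real (N i) + 2 * s)"

definition frac_lap ::
    "(nat \<Rightarrow> real ^ 'n) \<Rightarrow> (nat \<Rightarrow> nat) \<Rightarrow> nat \<Rightarrow> real \<Rightarrow> (real ^ 'n \<Rightarrow> real) \<Rightarrow> real ^ 'n \<Rightarrow> real" where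
  "frac_lap e N i s u x =
     (if s = 1
      then - (\<Sum>j = block_end N (i - 1) + 1..block_end N i. partial (e j) (partial (e j) u) x)
      else frac_const (N i) s * (LINT y|Pi\<^sub>M {1..N i} (\<lambda>_. lborel). frac_integrand e N i s u x y))"

text \<open>
  Since \<open>deriv\<close> and the Bochner integral are total functions, the pointwise meaningfulness
  of \<open>frac_lap\<close> has to be required separately.
\<close>

definition frac_lap_defined ::
    "(nat \<Rightarrow> real ^ 'n) \<Rightarrow> (nat \<Rightarrow> nat) \<Rightarrow> nat \<Rightarrow> real \<Rightarrow> (real ^ 'n \<Rightarrow> real) \<Rightarrow> real ^ 'n \<Rightarrow> bool" where
  "frac_lap_defined e N i s u x \<longleftrightarrow>
     (if s = 1
      then \<forall>j \<in> {block_end N (i - 1) + 1..block_end N i}. has_partial2 (e j) u x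
      else integrable (Pi\<^sub>M {1..N i} (\<lambda>_. lborel)) (frac_integrand e N i s u x))"

definition aniso_op ::
    "(nat \<Rightarrow> real ^ 'n) \<Rightarrow> nat \<Rightarrow> (nat \<Rightarrow> nat) \<Rightarrow> (nat \<Rightarrow> real) \<Rightarrow> (nat \<Rightarrow> real)
      \<Rightarrow> (real ^ 'n \<Rightarrow> real) \<Rightarrow> real ^ 'n \<Rightarrow> real" where
  "aniso_op e m N a s u x = (\<Sum>i=1..m. a i * frac_lap e N i (s i) u x)"

text \<open>
  A classical solution of \<open>L u = f\<close> in \<open>\<Omega>\<close>. No regularity is asked in the blocks with
  \<open>a i = 0\<close>, which do not occur in \<open>L\<close>.
\<close>

definition classical_solution ::
    "(nat \<Rightarrow> real ^ 'n) \<Rightarrow> nat \<Rightarrow> (nat \<Rightarrow> nat) \<Rightarrow> (nat \<Rightarrow> real) \<Rightarrow> (nat \<Rightarrow> real)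
      \<Rightarrow> (real ^ 'n \<Rightarrow> real) \<Rightarrow> (real ^ 'n) set \<Rightarrow> (real ^ 'n \<Rightarrow> real) \<Rightarrow> bool" where
  "classical_solution e m N a s f \<Omega> u \<longleftrightarrow>
     continuous_on UNIV u \<and>
     (\<forall>x\<in>\<Omega>. (\<forall>i\<in>{1..m}. a i \<noteq> 0 \<longrightarrow> frac_lap_defined e N i (s i) u x)
            \<and> aniso_op e m N a s u x = f x)"

definition Linf_norm :: "(real ^ 'n) set \<Rightarrow> (real ^ 'n \<Rightarrow> real) \<Rightarrow> ereal" where
  "Linf_norm S u = esssup (lebesgue_on S) (\<lambda>x. ereal \<bar>u x\<bar>)"

definition indep_of_dir :: "real ^ 'n \<Rightarrow> (real ^ 'n \<Rightarrow> real) \<Rightarrow> bool" where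
  "indep_of_dir v g \<longleftrightarrow> (\<forall>x t. g (x + t *\<^sub>R v) = g x)"

end

theory Submission
  imports Defs
begin

text \<open>
  Let \<open>v\<close> be the last basis vector or its negative. The idea is to study the odd part
  \<open>w (x, t) = u (x + t v) - u (x - t v)\<close> for \<open>t \<ge> 0\<close> as a function of \<open>n + 1\<close> variables. Since
  \<open>w\<close> has the same second derivative in \<open>t\<close> as in the last coordinate of \<open>x\<close>, and
  \<open>f\<close> does not see the shift along \<open>v\<close>, the function \<open>w\<close> solves a homogeneous equation in which the
  operators of the first \<open>m - 1\<close> blocks act in \<open>x\<close> and \<open>- a m\<close> times the second derivative acts in \<open>t\<close>.
  It vanishes for \<open>t = 0\<close>, so it can be compared on the strip \<open>0 \<le> t \<le> R\<close> with the barrier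
  \<open>\<eta> * (((norm x)\<^sup>2 + R\<^sup>2) powr (\<sigma> / 2) - R powr \<sigma> + K * (2 * t - t\<^sup>2 / R))\<close>.

  For large \<open>R\<close> the barrier is above \<open>w\<close> at \<open>t = R\<close> and for large \<open>norm x\<close>, because \<open>u\<close> grows more slowly than
  \<open>norm x powr \<sigma>\<close>. If it were not above \<open>w\<close> everywhere, their difference would have a maximum
  inside the strip, at points \<open>P = x + t v\<close> and \<open>Q = x - t v\<close> (\<open>doubled_maximum_point\<close>). There all second
  differences of \<open>w\<close> are bounded by those of the barrier. In the first blocks the contribution is at
  least \<open>- \<eta> * C * R powr (\<sigma> - 2 * s i)\<close> (\<open>block_difference_ge\<close>), and this is where \<open>\<sigma> = 2 * min s - 1\<close> enters:
  the power is at most \<open>1 / R\<close>, exactly the size \<open>2 * \<eta> * K / R\<close> of the concavity of the barrier in \<open>t\<close>. A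
  large constant \<open>K\<close>, independent of \<open>R\<close> and \<open>\<eta>\<close>, therefore makes \<open>L u P - L u Q\<close> positive, although it is
  \<open>f P - f Q = 0\<close>. Hence the barrier bounds \<open>w\<close>. Letting \<open>R\<close> grow at a fixed \<open>(x, t)\<close> and then \<open>\<eta> \<rightarrow> 0\<close> gives \<open>w \<le> 0\<close>.
  With both signs of \<open>v\<close>, \<open>u (x + t v) = u (x - t v)\<close> for all \<open>x\<close> and \<open>t\<close>, that is, \<open>u\<close> is constant along \<open>v\<close>.

  Since \<open>u\<close> has only the regularity that makes \<open>L u\<close> meaningful, everything is expressed through
  second differences of \<open>u\<close>, at the two points simultaneously; for the barrier they are estimated by
  concavity alone.
\<close>

section \<open>A concave power of the squared distance\<close>

text \<open>
  Young's inequality for the weights \<open>p\<close> and \<open>1 - p\<close>, divided by \<open>M powr (1 - p)\<close>,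
  is the tangent line bound of the concave function \<open>z powr p\<close> at \<open>M\<close>.
\<close>

lemma powr_le_tangent:
  fixes a M p :: real
  assumes p: "0 \<le> p" "p \<le> 1" and a: "0 \<le> a" and M: "0 < M"
  shows "a powr p \<le> M powr p + p * M powr (p - 1) * (a - M)"
proof -
  have M1: "M powr (p - 1) * M = M powr p"
    using M powr_add[of M "p - 1" 1] by simp
  show ?thesis
  proof (cases "a = 0")
    case True
    then have "M powr p + p * M powr (p - 1) * (a - M) = (1 - p) * M powr p"
      using M1 by (simp add: algebra_simps)
    then show ?thesis using True p by simp
  next
    case False
    have "a powr p * M powr (1 - p) \<le> p * a + (1 - p) * M"
      using Youngs_inequality_0[of p "1 - p" a M] p a M False by simp
    then have "a powr p * M powr (1 - p) * M powr (p - 1) \<le> (p * a + (1 - p) * M) * M powr (p - 1)"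
      by (intro mult_right_mono) auto
    moreover have "M powr (1 - p) * M powr (p - 1) = 1"
      using M by (simp flip: powr_add)
    moreover have "(p * a + (1 - p) * M) * M powr (p - 1) = M powr p + p * M powr (p - 1) * (a - M)"
      using M1 by (simp add: algebra_simps)
    ultimately show ?thesis by (simp add: mult.assoc)
  qed
qed

text \<open>
  After division by \<open>(a + b) powr p\<close> both arguments lie in \<open>[0, 1]\<close>, where \<open>z \<le> z powr p\<close>.
\<close>

lemma powr_add_le:
  fixes a b p :: real
  assumes p: "0 \<le> p" "p \<le> 1" and ab: "0 \<le> a" "0 \<le> b"
  shows "(a + b) powr p \<le> a powr p + b powr p"
proof (cases "a + b = 0")
  case False
  then have S: "0 < a + b" using ab by simp
  have le: "z \<le> z powr p" if "0 \<le> z" "z \<le> 1" for z :: real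
    using powr_mono'[of p 1 z] that p by simp
  have "1 = a / (a + b) + b / (a + b)" using S by (simp flip: add_divide_distrib)
  also have "\<dots> \<le> (a / (a + b)) powr p + (b / (a + b)) powr p"
    using ab S by (intro add_mono le) auto
  also have "\<dots> = (a powr p + b powr p) / (a + b) powr p"
    using ab S by (simp add: powr_divide add_divide_distrib)
  finally show ?thesis using S by (simp add: pos_le_divide_eq)
qed (use ab in auto)

text \<open>
  The part of the barrier that makes the maximum principle work on an unbounded set: it grows
  like \<open>norm x powr \<sigma>\<close>, faster than \<open>u\<close>, and it is flat at the scale \<open>R\<close>.
\<close>

definition bowl :: "real \<Rightarrow> real \<Rightarrow> 'a::real_inner \<Rightarrow> real" where
  "bowl \<sigma> R x = ((norm x)\<^sup>2 + R\<^sup>2) powr (\<sigma> / 2)"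

text \<open>
  Half of a bound for the second differences of \<open>bowl \<sigma> R\<close> with an increment of length \<open>r\<close>.
  The quadratic term is smaller for \<open>r < R\<close> and makes the singularity of the fractional kernel
  integrable; the term \<open>r powr \<sigma>\<close> makes the tail integrable.
\<close>

definition bowl_modulus :: "real \<Rightarrow> real \<Rightarrow> real \<Rightarrow> real" where
  "bowl_modulus \<sigma> R r = min (R powr (\<sigma> - 2) * r\<^sup>2) (r powr \<sigma>)"

lemma power2_powr_half: "0 \<le> r \<Longrightarrow> (r\<^sup>2) powr (\<sigma> / 2) = r powr \<sigma>" for r :: real
  by (cases "r = 0") (simp_all add: powr_powr flip: powr_numeral)

lemma powr_increment_le_bowl_modulus:
  assumes \<sigma>: "0 < \<sigma>" "\<sigma> \<le> 1" and R: "0 < R" and r: "0 \<le> r" and A: "R\<^sup>2 \<le> A"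
  shows "(A + r\<^sup>2) powr (\<sigma> / 2) - A powr (\<sigma> / 2) \<le> bowl_modulus \<sigma> R r"
proof -
  have A0: "0 < A" using R A by (meson less_le_trans zero_less_power)
  have "(A + r\<^sup>2) powr (\<sigma> / 2) \<le> A powr (\<sigma> / 2) + (\<sigma> / 2) * A powr (\<sigma> / 2 - 1) * r\<^sup>2"
    using powr_le_tangent[of "\<sigma> / 2" "A + r\<^sup>2" A] \<sigma> A0 by simp
  also have "(\<sigma> / 2) * A powr (\<sigma> / 2 - 1) * r\<^sup>2 \<le> 1 * (R\<^sup>2) powr (\<sigma> / 2 - 1) * r\<^sup>2"
    using \<sigma> A R by (intro mult_mono powr_mono2') auto
  also have "(R\<^sup>2) powr (\<sigma> / 2 - 1) = R powr (\<sigma> - 2)"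
    using power2_powr_half[of R "\<sigma> - 2"] R by (simp add: diff_divide_distrib)
  finally have 1: "(A + r\<^sup>2) powr (\<sigma> / 2) - A powr (\<sigma> / 2) \<le> R powr (\<sigma> - 2) * r\<^sup>2" by simp
  have "(A + r\<^sup>2) powr (\<sigma> / 2) \<le> A powr (\<sigma> / 2) + (r\<^sup>2) powr (\<sigma> / 2)"
    using powr_add_le[of "\<sigma> / 2" A "r\<^sup>2"] \<sigma> A0 by simp
  then have 2: "(A + r\<^sup>2) powr (\<sigma> / 2) - A powr (\<sigma> / 2) \<le> r powr \<sigma>"
    using power2_powr_half[OF r, of \<sigma>] by simp
  show ?thesis using 1 2 by (simp add: bowl_modulus_def)
qed

text \<open>
  By the parallelogram law the values of \<open>(norm \<cdot>)\<^sup>2 + R\<^sup>2\<close> at \<open>x + y\<close> and \<open>x - y\<close> have the mean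
  \<open>M = (norm x)\<^sup>2 + R\<^sup>2 + (norm y)\<^sup>2\<close>, so concavity of the power bounds the sum of the two powers by
  \<open>2 * M powr (\<sigma> / 2)\<close>. Since the bound depends on \<open>y\<close> through \<open>norm y\<close> only and
  not on \<open>x\<close>, it serves all blocks and all orders at once.
\<close>

lemma bowl_second_difference_le:
  fixes x y :: "'a::real_inner"
  assumes \<sigma>: "0 < \<sigma>" "\<sigma> \<le> 1" and R: "0 < R"
  shows "bowl \<sigma> R (x + y) + bowl \<sigma> R (x - y) - 2 * bowl \<sigma> R x \<le> 2 * bowl_modulus \<sigma> R (norm y)"
proof -
  define A where "A = (norm x)\<^sup>2 + R\<^sup>2"
  define M where "M = A + (norm y)\<^sup>2"
  define a where "a = (norm (x + y))\<^sup>2 + R\<^sup>2"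
  define b where "b = (norm (x - y))\<^sup>2 + R\<^sup>2"
  have M0: "0 < M" using R by (simp add: M_def A_def add_nonneg_pos add_pos_nonneg)
  have ab: "a + b = 2 * M"
    by (simp add: a_def b_def M_def A_def power2_norm_eq_inner inner_simps inner_commute)
  define q where "q = \<sigma> / 2 * M powr (\<sigma> / 2 - 1)"
  have "a powr (\<sigma> / 2) \<le> M powr (\<sigma> / 2) + q * (a - M)"
    "b powr (\<sigma> / 2) \<le> M powr (\<sigma> / 2) + q * (b - M)"
    unfolding q_def by (rule powr_le_tangent; use \<sigma> M0 in \<open>simp add: a_def b_def\<close>)+
  moreover have "q * (a - M) + q * (b - M) = q * (a + b - 2 * M)"
    by (simp add: algebra_simps)
  ultimately have "a powr (\<sigma> / 2) + b powr (\<sigma> / 2) \<le> 2 * M powr (\<sigma> / 2)"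
    using ab by simp
  moreover have "M powr (\<sigma> / 2) - A powr (\<sigma> / 2) \<le> bowl_modulus \<sigma> R (norm y)"
    unfolding M_def by (rule powr_increment_le_bowl_modulus) (use \<sigma> R in \<open>auto simp: A_def\<close>)
  ultimately show ?thesis by (simp add: bowl_def a_def b_def A_def)
qed

section \<open>Second derivatives and second differences\<close>

text \<open>
  Otherwise \<open>g t + g (- t) - c * t\<^sup>2\<close>, whose derivative vanishes at \<open>0\<close> and has the positive
  derivative \<open>2 * (D - c)\<close> there, would be strictly increasing on some \<open>[0, t]\<close>.
\<close>

lemma second_derivative_le:
  fixes g g' :: "real \<Rightarrow> real"
  assumes g: "\<forall>\<^sub>F t in nhds 0. (g has_real_derivative g' t) (at t)"
    and g': "(g' has_real_derivative D) (at 0)"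
    and le: "\<forall>\<^sub>F t in at_right 0. g t + g (- t) - 2 * g 0 \<le> c * t\<^sup>2"
  shows "D \<le> c"
proof (rule ccontr)
  assume "\<not> D \<le> c"
  define k where "k t = g t + g (- t) - c * t\<^sup>2" for t
  define k' where "k' t = g' t - g' (- t) - 2 * c * t" for t
  obtain d1 where d1: "d1 > 0" "\<And>t. \<bar>t\<bar> < d1 \<Longrightarrow> (g has_real_derivative g' t) (at t)"
    using g unfolding eventually_nhds_metric by (auto simp: dist_real_def)
  obtain d2 where d2: "d2 > 0" "\<And>t. 0 < t \<Longrightarrow> t < d2 \<Longrightarrow> g t + g (- t) - 2 * g 0 \<le> c * t\<^sup>2"
    using le unfolding eventually_at_right_field by auto
  have k: "(k has_real_derivative k' t) (at t)" if "\<bar>t\<bar> < d1" for t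
  proof -
    have "((\<lambda>t. g (- t)) has_real_derivative g' (- t) * (- 1)) (at t)"
      by (rule DERIV_chain'[OF _ d1(2)]) (use that in \<open>auto intro!: derivative_eq_intros\<close>)
    with d1(2)[OF that] show ?thesis
      unfolding k_def k'_def by (auto intro!: derivative_eq_intros)
  qed
  have "((\<lambda>t. g' (- t)) has_real_derivative D * (- 1)) (at 0)"
    by (rule DERIV_chain'[where f = uminus]) (use g' in \<open>auto intro!: derivative_eq_intros\<close>)
  with g' have "(k' has_real_derivative 2 * (D - c)) (at 0)"
    unfolding k'_def by (auto intro!: derivative_eq_intros)
  then obtain d3 where d3: "d3 > 0" "\<And>h. 0 < h \<Longrightarrow> h < d3 \<Longrightarrow> k' 0 < k' h"
    using DERIV_pos_inc_right[of k' "2 * (D - c)" 0] \<open>\<not> D \<le> c\<close> by auto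
  define t where "t = Min {d1, d2, d3} / 2"
  have t: "0 < t" "t < d1" "t < d2" "t < d3"
    using d1(1) d2(1) d3(1) by (auto simp: t_def min_def)
  have "k 0 < k t"
  proof (rule DERIV_pos_imp_increasing_open[OF t(1)])
    fix x assume x: "0 < x" "x < t"
    have "0 < k' x" using d3(2)[of x] x t by (simp add: k'_def)
    then show "\<exists>y. (k has_real_derivative y) (at x) \<and> 0 < y" using k[of x] x t by auto
  next
    show "continuous_on {0..t} k"
      by (intro continuous_at_imp_continuous_on ballI DERIV_isCont[OF k]) (use t in auto)
  qed
  then show False using d2(2)[of t] t by (simp add: k_def)
qed

lemma has_partial2_derivatives:
  fixes u :: "real ^ 'n \<Rightarrow> real"
  assumes "has_partial2 v u P"
  shows "\<forall>\<^sub>F t in nhds 0. ((\<lambda>t. u (P + t *\<^sub>R v)) has_real_derivative partial v u (P + t *\<^sub>R v)) (at t)"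
    and "((\<lambda>t. partial v u (P + t *\<^sub>R v)) has_real_derivative partial v (partial v u) P) (at 0)"
proof -
  show "((\<lambda>t. partial v u (P + t *\<^sub>R v)) has_real_derivative partial v (partial v u) P) (at 0)"
    using assms unfolding has_partial2_def has_partial_def
    by (auto simp: partial_def[of v "partial v u"] field_differentiable_derivI)
  have "((\<lambda>t. u (P + t *\<^sub>R v)) has_real_derivative partial v u (P + t *\<^sub>R v)) (at t)"
    if "has_partial v u (P + t *\<^sub>R v)" for t
  proof -
    have "((\<lambda>r. u (P + t *\<^sub>R v + r *\<^sub>R v)) has_real_derivative partial v u (P + t *\<^sub>R v)) (at 0)"
      using that unfolding has_partial_def partial_def by (rule field_differentiable_derivI)
    then show ?thesis
      unfolding DERIV_shift[where z = t and x = 0, simplified, symmetric]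
      using DERIV_shift[of "\<lambda>t. u (P + t *\<^sub>R v)" "partial v u (P + t *\<^sub>R v)" 0 t]
      by (simp add: scaleR_add_left add.assoc add.commute add.left_commute)
  qed
  then show "\<forall>\<^sub>F t in nhds 0. ((\<lambda>t. u (P + t *\<^sub>R v)) has_real_derivative partial v u (P + t *\<^sub>R v)) (at t)"
    using assms unfolding has_partial2_def by (auto elim!: eventually_mono)
qed

text \<open>
  A bound on the difference of the second differences of \<open>u\<close> at two points passes to the second
  derivatives; the two points enter jointly, as \<open>u\<close> alone satisfies no such bound.
\<close>

lemma partial2_difference_le:
  fixes u :: "real ^ 'n \<Rightarrow> real"
  assumes P: "has_partial2 v u P" and Q: "has_partial2 v u Q"
    and le: "\<forall>\<^sub>F t in at_right 0.
      (u (P + t *\<^sub>R v) + u (P - t *\<^sub>R v) - 2 * u P) - (u (Q + t *\<^sub>R v) + u (Q - t *\<^sub>R v) - 2 * u Q) \<le> c * t\<^sup>2"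
  shows "partial v (partial v u) P - partial v (partial v u) Q \<le> c"
proof (rule second_derivative_le)
  let ?g = "\<lambda>t. u (P + t *\<^sub>R v) - u (Q + t *\<^sub>R v)"
  let ?g' = "\<lambda>t. partial v u (P + t *\<^sub>R v) - partial v u (Q + t *\<^sub>R v)"
  show "\<forall>\<^sub>F t in nhds 0. (?g has_real_derivative ?g' t) (at t)"
    using has_partial2_derivatives(1)[OF P] has_partial2_derivatives(1)[OF Q]
    by eventually_elim (rule DERIV_diff)
  show "(?g' has_real_derivative partial v (partial v u) P - partial v (partial v u) Q) (at 0)"
    by (intro DERIV_diff has_partial2_derivatives(2) P Q)
  show "\<forall>\<^sub>F t in at_right 0. ?g t + ?g (- t) - 2 * ?g 0 \<le> c * t\<^sup>2"
    using le by eventually_elim simp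
qed

section \<open>Integrating the singular kernel over dyadic shells\<close>

text \<open>
  The function \<open>g\<close> is dominated by the sum over \<open>k\<close> of the constants \<open>B * \<theta> ^ k / r k ^ d\<close> times
  the indicators of the sets \<open>\<rho> \<le> r k\<close>. Each set has at most the volume \<open>c * r k ^ d\<close>, so the
  radii cancel and a geometric series remains. Only the volume growth of the sublevel sets
  enters, which replaces polar coordinates on a block whose dimension is a number and not a type.
\<close>

lemma nn_integral_shells_le:
  fixes M :: "'a measure" and \<rho> g :: "'a \<Rightarrow> real" and r :: "nat \<Rightarrow> real"
  assumes [measurable]: "\<rho> \<in> borel_measurable M"
    and vol: "\<And>r. 0 < r \<Longrightarrow> emeasure M {y \<in> space M. \<rho> y \<le> r} \<le> ennreal (c * r ^ d)"
    and r: "\<And>k. 0 < r k" and c: "0 \<le> c" and B: "0 \<le> B" and \<theta>: "0 \<le> \<theta>" "\<theta> < 1"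
    and g: "\<And>y. y \<in> space M \<Longrightarrow> 0 < g y \<Longrightarrow> \<exists>k. \<rho> y \<le> r k \<and> g y \<le> B * \<theta> ^ k / r k ^ d"
  shows "(\<integral>\<^sup>+ y. ennreal (g y) \<partial>M) \<le> ennreal (c * B / (1 - \<theta>))"
proof -
  let ?S = "\<lambda>k. {y \<in> space M. \<rho> y \<le> r k}"
  have term_le: "f k \<le> suminf f" for f :: "nat \<Rightarrow> ennreal" and k
    using sum_le_suminf[of f "{k}"] by auto
  let ?h = "\<lambda>k y. ennreal (B * \<theta> ^ k / r k ^ d) * indicator (?S k) y"
  have "(\<integral>\<^sup>+ y. ennreal (g y) \<partial>M) \<le> (\<integral>\<^sup>+ y. (\<Sum>k. ?h k y) \<partial>M)"
  proof (rule nn_integral_mono)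
    fix y assume y: "y \<in> space M"
    show "ennreal (g y) \<le> (\<Sum>k. ?h k y)"
    proof (cases "0 < g y")
      case True
      then obtain k where k: "\<rho> y \<le> r k" "g y \<le> B * \<theta> ^ k / r k ^ d" using g[OF y] by blast
      have "ennreal (g y) \<le> ?h k y" using k y by (simp add: ennreal_leI)
      also have "\<dots> \<le> (\<Sum>k. ?h k y)"
        by (rule term_le)
      finally show ?thesis .
    qed (simp add: ennreal_neg)
  qed
  also have "\<dots> = (\<Sum>k. \<integral>\<^sup>+ y. ?h k y \<partial>M)"
    by (rule nn_integral_suminf) simp
  also have "\<dots> \<le> (\<Sum>k. ennreal (c * B * \<theta> ^ k))"
  proof (rule suminf_le)
    fix k
    have "(\<integral>\<^sup>+ y. ?h k y \<partial>M) = ennreal (B * \<theta> ^ k / r k ^ d) * emeasure M (?S k)"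
      by (simp add: nn_integral_cmult)
    also have "\<dots> \<le> ennreal (B * \<theta> ^ k / r k ^ d) * ennreal (c * r k ^ d)"
      by (intro mult_left_mono vol r) auto
    also have "\<dots> = ennreal (c * B * \<theta> ^ k)"
      using r[of k] B \<theta> c by (simp flip: ennreal_mult add: mult_ac)
    finally show "(\<integral>\<^sup>+ y. ?h k y \<partial>M) \<le> ennreal (c * B * \<theta> ^ k)" .
  qed auto
  also have "\<dots> = ennreal (\<Sum>k. c * B * \<theta> ^ k)"
    using c B \<theta> by (intro suminf_ennreal2) (auto intro!: summable_mult summable_geometric)
  also have "(\<Sum>k. c * B * \<theta> ^ k) = c * B / (1 - \<theta>)"
    using \<theta> by (subst suminf_mult) (auto intro!: summable_geometric simp: suminf_geometric)
  finally show ?thesis .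
qed

lemma power_of_two_interval:
  fixes z :: real
  assumes "1 \<le> z"
  obtains k :: nat where "2 ^ k \<le> z" "z < 2 ^ Suc k"
proof -
  define n where "n = (LEAST n. z < 2 ^ n)"
  have n: "z < 2 ^ n"
    unfolding n_def by (rule LeastI_ex) (use real_arch_pow[of 2 z] in auto)
  then obtain k where k: "n = Suc k" using assms by (cases n) auto
  have "\<not> z < 2 ^ k"
    using not_less_Least[of k "\<lambda>n. z < 2 ^ n"] k by (simp flip: n_def)
  with n k that[of k] show thesis by simp
qed

text \<open>
  The scaling \<open>R powr (\<sigma> - 2 * s)\<close> with a constant independent of \<open>R\<close> is the point. The part
  \<open>\<rho> < R\<close> is covered by the radii \<open>R / 2 ^ k\<close>, with ratio \<open>2 powr (2 * s - 2)\<close>, and the part \<open>\<rho> \<ge> R\<close> by the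
  radii \<open>2 ^ Suc k * R\<close>, with ratio \<open>2 powr (\<sigma> - 2 * s)\<close>. The hypotheses \<open>s < 1\<close> and
  \<open>\<sigma> < 2 * s\<close> say that these ratios are below \<open>1\<close>.
\<close>

lemma nn_integral_bowl_modulus_le:
  fixes M :: "'a measure" and \<rho> :: "'a \<Rightarrow> real"
  assumes [measurable]: "\<rho> \<in> borel_measurable M"
    and vol: "\<And>r. 0 < r \<Longrightarrow> emeasure M {y \<in> space M. \<rho> y \<le> r} \<le> ennreal (c * r ^ d)"
    and \<rho>: "\<And>y. 0 \<le> \<rho> y" and c: "0 \<le> c" and s: "\<sigma> < 2 * s" "s < 1" and R: "0 < R"
  shows "(\<integral>\<^sup>+ y. ennreal (bowl_modulus \<sigma> R (\<rho> y) / \<rho> y powr (d + 2 * s)) \<partial>M)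
    \<le> ennreal (c * 2 ^ d * (1 / (1 - 2 powr (2 * s - 2)) + 1 / (1 - 2 powr (\<sigma> - 2 * s))) * R powr (\<sigma> - 2 * s))"
proof -
  define g where "g y = bowl_modulus \<sigma> R (\<rho> y) / \<rho> y powr (d + 2 * s)" for y
  define g1 where "g1 y = (if \<rho> y < R then g y else 0)" for y
  define g2 where "g2 y = (if \<rho> y < R then 0 else g y)" for y
  define B where "B = 2 ^ d * R powr (\<sigma> - 2 * s)"
  have g0: "0 \<le> g y" for y by (simp add: g_def bowl_modulus_def)
  have [measurable]: "g \<in> borel_measurable M" unfolding g_def bowl_modulus_def by measurable
  have [measurable]: "g1 \<in> borel_measurable M" "g2 \<in> borel_measurable M"
    unfolding g1_def g2_def by measurable
  have B: "0 \<le> B" by (simp add: B_def)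
  have powr_lt: "(2::real) powr z < 1" if "z < 0" for z
    using powr_less_mono[of z 0 2] that by simp
  have near: "(\<integral>\<^sup>+ y. ennreal (g1 y) \<partial>M) \<le> ennreal (c * B / (1 - 2 powr (2 * s - 2)))"
  proof (rule nn_integral_shells_le[where r = "\<lambda>k. R / 2 ^ k" and \<rho> = \<rho> and d = d])
    fix y assume "0 < g1 y"
    then have y: "\<rho> y < R" "0 < g y" by (auto simp: g1_def split: if_splits)
    then have p: "0 < \<rho> y" using \<rho>[of y] by (cases "\<rho> y = 0") (auto simp: g_def)
    obtain k where k: "2 ^ k \<le> R / \<rho> y" "R / \<rho> y < 2 ^ Suc k"
      using power_of_two_interval[of "R / \<rho> y"] p y by auto
    define r where "r = R / 2 ^ k"
    have r: "0 < r" "\<rho> y \<le> r" "r / 2 \<le> \<rho> y" using k R p by (auto simp: r_def field_simps)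
    have "g y \<le> (R powr (\<sigma> - 2) * (\<rho> y)\<^sup>2) / \<rho> y powr (d + 2 * s)"
      unfolding g_def by (intro divide_right_mono) (auto simp: bowl_modulus_def)
    also have "\<dots> = R powr (\<sigma> - 2) * \<rho> y powr (2 - 2 * s) / \<rho> y ^ d"
      using p by (simp add: powr_add powr_diff powr_realpow flip: powr_numeral)
    also have "\<dots> \<le> R powr (\<sigma> - 2) * r powr (2 - 2 * s) / (r / 2) ^ d"
      using r p s by (intro frac_le mult_left_mono powr_mono2 power_mono) auto
    also have "\<dots> = B * (2 powr (2 * s - 2)) ^ k / r ^ d"
    proof -
      have "r powr (2 - 2 * s) = R powr (2 - 2 * s) * (2 powr (2 * s - 2)) ^ k"
      proof -
        have "r = R * 2 powr (- real k)"
          by (simp add: r_def powr_minus powr_realpow divide_inverse)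
        then have "r powr (2 - 2 * s) = R powr (2 - 2 * s) * 2 powr (- real k * (2 - 2 * s))"
          using R by (simp add: powr_mult powr_powr)
        also have "2 powr (- real k * (2 - 2 * s)) = (2 powr (2 * s - 2)) ^ k"
          by (simp add: powr_power algebra_simps)
        finally show ?thesis .
      qed
      moreover have "R powr (\<sigma> - 2) * R powr (2 - 2 * s) = R powr (\<sigma> - 2 * s)"
        using R by (simp flip: powr_add)
      ultimately show ?thesis by (simp add: B_def power_divide mult_ac)
    qed
    finally show "\<exists>k. \<rho> y \<le> R / 2 ^ k \<and> g1 y \<le> B * (2 powr (2 * s - 2)) ^ k / (R / 2 ^ k) ^ d"
      using r y by (intro exI[of _ k]) (simp add: g1_def flip: r_def)
  qed (use vol R c B s powr_lt in auto)
  have far: "(\<integral>\<^sup>+ y. ennreal (g2 y) \<partial>M) \<le> ennreal (c * B / (1 - 2 powr (\<sigma> - 2 * s)))"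
  proof (rule nn_integral_shells_le[where r = "\<lambda>k. 2 ^ Suc k * R" and \<rho> = \<rho> and d = d])
    fix y assume "0 < g2 y"
    then have y: "R \<le> \<rho> y" by (auto simp: g2_def split: if_splits)
    then have p: "0 < \<rho> y" using R by simp
    obtain k where k: "2 ^ k \<le> \<rho> y / R" "\<rho> y / R < 2 ^ Suc k"
      using power_of_two_interval[of "\<rho> y / R"] R y by auto
    define r where "r = 2 ^ Suc k * R"
    have r: "0 < r" "\<rho> y \<le> r" "r / 2 \<le> \<rho> y" "2 ^ k * R \<le> \<rho> y"
      using k R p by (auto simp: r_def field_simps)
    have "g y \<le> \<rho> y powr \<sigma> / \<rho> y powr (d + 2 * s)"
      unfolding g_def by (intro divide_right_mono) (auto simp: bowl_modulus_def)
    also have "\<dots> = \<rho> y powr (\<sigma> - 2 * s) / \<rho> y ^ d"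
      using p by (simp add: powr_add powr_diff powr_realpow)
    also have "\<dots> \<le> (2 ^ k * R) powr (\<sigma> - 2 * s) / (r / 2) ^ d"
      using r p s R by (intro frac_le powr_mono2' power_mono) auto
    also have "\<dots> = B * (2 powr (\<sigma> - 2 * s)) ^ k / r ^ d"
    proof -
      have "(2 ^ k * R) powr (\<sigma> - 2 * s) = R powr (\<sigma> - 2 * s) * (2 powr (\<sigma> - 2 * s)) ^ k"
        using R by (simp add: powr_mult powr_realpow[symmetric] powr_powr mult_ac)
      then show ?thesis by (simp add: B_def power_divide mult_ac)
    qed
    finally show "\<exists>k. \<rho> y \<le> 2 ^ Suc k * R \<and> g2 y \<le> B * (2 powr (\<sigma> - 2 * s)) ^ k / (2 ^ Suc k * R) ^ d"
      using r y unfolding r_def by (intro exI[of _ k]) (simp add: g2_def)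
  qed (use vol R c B s powr_lt in auto)
  have "(\<integral>\<^sup>+ y. ennreal (g y) \<partial>M) = (\<integral>\<^sup>+ y. ennreal (g1 y) + ennreal (g2 y) \<partial>M)"
    by (rule nn_integral_cong) (simp add: g1_def g2_def)
  also have "\<dots> = (\<integral>\<^sup>+ y. ennreal (g1 y) \<partial>M) + (\<integral>\<^sup>+ y. ennreal (g2 y) \<partial>M)"
    by (rule nn_integral_add) auto
  also have "\<dots> \<le> ennreal (c * B / (1 - 2 powr (2 * s - 2))) + ennreal (c * B / (1 - 2 powr (\<sigma> - 2 * s)))"
    by (intro add_mono near far)
  also have "\<dots> = ennreal (c * B / (1 - 2 powr (2 * s - 2)) + c * B / (1 - 2 powr (\<sigma> - 2 * s)))"
    using c B s powr_lt by (intro ennreal_plus[symmetric] divide_nonneg_pos mult_nonneg_nonneg) auto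
  finally show ?thesis by (simp add: g_def B_def algebra_simps)
qed

text \<open>
  The ball is contained in a cube of side \<open>2 * r\<close>, since each coordinate of \<open>y\<close> is an inner product of
  \<open>block_vec e N i y\<close> with a basis vector.
\<close>

lemma emeasure_norm_block_vec_le:
  fixes e :: "nat \<Rightarrow> real ^ 'n"
  assumes inj: "inj_on e {1..CARD('n)}" and e: "e ` {1..CARD('n)} \<subseteq> Basis"
    and i: "1 \<le> i" and le: "block_end N i \<le> CARD('n)" and r: "0 < r"
  shows "emeasure (Pi\<^sub>M {1..N i} (\<lambda>_. lborel)) {y \<in> space (Pi\<^sub>M {1..N i} (\<lambda>_. lborel)). norm (block_vec e N i y) \<le> r}
    \<le> ennreal (2 ^ N i * r ^ N i)"
proof -
  interpret product_sigma_finite "\<lambda>_::nat. lborel :: real measure" ..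
  let ?b = "block_end N (i - 1)"
  have be: "block_end N i = ?b + N i"
    using i by (cases i) (auto simp: block_end_def)
  have coord: "\<bar>y k\<bar> \<le> norm (block_vec e N i y)" if k: "k \<in> {1..N i}" for y k
  proof -
    have "block_vec e N i y \<bullet> e (?b + k) = (\<Sum>j=1..N i. if j = k then y j else 0)"
      unfolding block_vec_def inner_sum_left
    proof (rule sum.cong)
      fix j assume j: "j \<in> {1..N i}"
      have "e (?b + j) = e (?b + k) \<longleftrightarrow> j = k"
        using inj_on_eq_iff[OF inj, of "?b + j" "?b + k"] j k le be by auto
      moreover have "e (?b + j) \<in> Basis" "e (?b + k) \<in> Basis"
        using e j k le be by (auto simp: image_subset_iff)
      ultimately show "(y j *\<^sub>R e (?b + j)) \<bullet> e (?b + k) = (if j = k then y j else 0)"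
        by (simp add: inner_Basis)
    qed simp
    also have "\<dots> = y k" using k by simp
    finally have "y k = block_vec e N i y \<bullet> e (?b + k)" by simp
    moreover have "e (?b + k) \<in> Basis" using e k le be by (auto simp: image_subset_iff)
    ultimately show ?thesis using Basis_le_norm by metis
  qed
  have "{y \<in> space (Pi\<^sub>M {1..N i} (\<lambda>_. lborel)). norm (block_vec e N i y) \<le> r}
      \<subseteq> Pi\<^sub>E {1..N i} (\<lambda>_. {-r..r::real})"
  proof (rule subsetI)
    fix y assume y: "y \<in> {y \<in> space (Pi\<^sub>M {1..N i} (\<lambda>_. lborel)). norm (block_vec e N i y) \<le> r}"
    have "y k \<in> {-r..r}" if "k \<in> {1..N i}" for k
    proof -
      have "\<bar>y k\<bar> \<le> r" using coord[OF that, of y] y by simp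
      then show ?thesis by (simp add: abs_le_iff)
    qed
    with y show "y \<in> Pi\<^sub>E {1..N i} (\<lambda>_. {-r..r})" by (simp add: space_PiM PiE_iff)
  qed
  then have "emeasure (Pi\<^sub>M {1..N i} (\<lambda>_. lborel)) {y \<in> space (Pi\<^sub>M {1..N i} (\<lambda>_. lborel)). norm (block_vec e N i y) \<le> r}
      \<le> emeasure (Pi\<^sub>M {1..N i} (\<lambda>_. lborel)) (Pi\<^sub>E {1..N i} (\<lambda>_. {-r..r::real}))"
    by (rule emeasure_mono) (rule sets_PiM_I_finite, simp_all)
  also have "\<dots> = (\<Prod>k\<in>{1..N i}. emeasure lborel {-r..r::real})"
    by (rule emeasure_PiM) auto
  also have "\<dots> = ennreal (2 ^ N i * r ^ N i)"
  proof -
    have "emeasure lborel {-r..r} = ennreal (2 * r)" using r by simp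
    then show ?thesis using r by (simp only: prod_constant ennreal_power) (simp add: power_mult_distrib)
  qed
  finally show ?thesis .
qed

section \<open>The maximum principle with doubled variable\<close>

text \<open>
  For a continuous function the essential supremum over an open ball bounds every value in the
  ball, because a closed set that contains almost every point of an open set contains all of it.
\<close>

lemma Linf_growth_pointwise:
  fixes u :: "real ^ 'n \<Rightarrow> real"
  assumes u: "continuous_on UNIV u" and \<epsilon>: "0 < \<epsilon>"
    and lim: "((\<lambda>R. Linf_norm (ball 0 R) u / ereal (R powr \<sigma>)) \<longlongrightarrow> 0) at_top"
  obtains R0 where "\<And>R z. R0 \<le> R \<Longrightarrow> norm z < R \<Longrightarrow> \<bar>u z\<bar> \<le> \<epsilon> * R powr \<sigma>"
proof -
  have "\<forall>\<^sub>F R in at_top. Linf_norm (ball 0 R) u / ereal (R powr \<sigma>) < ereal \<epsilon>"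
    using order_tendstoD(2)[OF lim, of "ereal \<epsilon>"] \<epsilon> by simp
  then obtain R0 where R0: "\<And>R. R0 \<le> R \<Longrightarrow> Linf_norm (ball 0 R) u / ereal (R powr \<sigma>) < ereal \<epsilon>"
    unfolding eventually_at_top_linorder by blast
  show thesis
  proof (rule that)
    fix R z assume R: "R0 \<le> R" and z: "norm (z :: real ^ 'n) < R"
    have pos: "0 < R powr \<sigma>" using z norm_ge_zero[of z] by (simp del: norm_ge_zero)
    have le: "Linf_norm (ball 0 R) u \<le> ereal (\<epsilon> * R powr \<sigma>)"
      using R0[OF R] pos
      by (cases "Linf_norm (ball 0 R) u") (auto simp: field_simps)
    have "AE x in lebesgue_on (ball 0 R). ereal \<bar>u x\<bar> \<le> Linf_norm (ball 0 R) u"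
      unfolding Linf_norm_def by (rule esssup_AE)
    then have "AE x in lebesgue_on (ball 0 R). x \<in> {x. \<bar>u x\<bar> \<le> \<epsilon> * R powr \<sigma>}"
    proof eventually_elim
      case (elim x)
      from order_trans[OF elim le] show ?case by simp
    qed
    then have ae: "AE x\<in>ball 0 R in lebesgue. x \<in> {x. \<bar>u x\<bar> \<le> \<epsilon> * R powr \<sigma>}"
      by (subst (asm) AE_restrict_space_iff) auto
    have "closed {x. \<bar>u x\<bar> \<le> \<epsilon> * R powr \<sigma>}"
      by (intro closed_Collect_le continuous_intros u)
    from mem_closed_if_AE_lebesgue_open[OF open_ball this ae] z
    have "z \<in> {x. \<bar>u x\<bar> \<le> \<epsilon> * R powr \<sigma>}" by simp
    then show "\<bar>u z\<bar> \<le> \<epsilon> * R powr \<sigma>" by simp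
  qed
qed

definition second_diff :: "('a::real_vector \<Rightarrow> real) \<Rightarrow> 'a \<Rightarrow> 'a \<Rightarrow> real" where
  "second_diff u x y = u (x + y) + u (x - y) - 2 * u x"

text \<open>
  The function \<open>F\<close> below is the odd part \<open>u (x + t v) - u (x - t v)\<close> minus the barrier. It is at most \<open>0\<close>
  for \<open>t = 0\<close> because the odd part vanishes and the barrier is nonnegative; it is at most \<open>0\<close> for
  \<open>t = R\<close> because there the barrier contains \<open>K * R \<ge> 2 * R powr \<sigma>\<close>, which together with the bowl
  exceeds the growth of \<open>u\<close>; and it is negative for large \<open>norm x\<close> because the bowl grows faster than \<open>u\<close>. So a positive
  value forces a maximum over all \<open>x\<close> and all \<open>t\<close> in \<open>[0, R]\<close>, and it lies at some \<open>0 < t < R\<close>. The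
  maximum is global in \<open>x\<close>, as nonlocal operators require: this gives the first conclusion.
  Varying \<open>t\<close> gives the second one, because moving \<open>t\<close> moves both \<open>x + t v\<close> and \<open>x - t v\<close> along \<open>v\<close>.
\<close>

lemma doubled_maximum_point:
  fixes u :: "'a::euclidean_space \<Rightarrow> real"
  assumes u: "continuous_on UNIV u" and v: "norm v = 1"
    and \<sigma>: "0 < \<sigma>" "\<sigma> \<le> 1" and \<eta>: "0 < \<eta>" and R: "1 \<le> R" and K: "2 \<le> K"
    and growth: "\<And>r z. R \<le> r \<Longrightarrow> norm z < r \<Longrightarrow> \<bar>u z\<bar> \<le> \<eta> / 4 * r powr \<sigma>"
    and t0: "0 \<le> t0" "t0 \<le> R"
    and above: "\<eta> * (bowl \<sigma> R x0 - R powr \<sigma> + K * (2 * t0 - t0\<^sup>2 / R))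
      < u (x0 + t0 *\<^sub>R v) - u (x0 - t0 *\<^sub>R v)"
  obtains x t where
    "\<And>y. second_diff u (x + t *\<^sub>R v) y - second_diff u (x - t *\<^sub>R v) y \<le> 2 * \<eta> * bowl_modulus \<sigma> R (norm y)"
    "\<forall>\<^sub>F r in at_right 0. second_diff u (x + t *\<^sub>R v) (r *\<^sub>R v) - second_diff u (x - t *\<^sub>R v) (r *\<^sub>R v)
      \<le> - (2 * \<eta> * K / R) * r\<^sup>2"
proof -
  define F where "F z = u (fst z + snd z *\<^sub>R v) - u (fst z - snd z *\<^sub>R v)
    - \<eta> * (bowl \<sigma> R (fst z) - R powr \<sigma> + K * (2 * snd z - (snd z)\<^sup>2 / R))" for z
  have Rs: "R powr \<sigma> \<le> R" "0 < R powr \<sigma>" using R \<sigma> powr_mono[of \<sigma> 1 R] by auto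
  have bowl_ge: "norm x powr \<sigma> \<le> bowl \<sigma> R x" "R powr \<sigma> \<le> bowl \<sigma> R x" for x :: 'a
  proof -
    have "((norm x)\<^sup>2) powr (\<sigma> / 2) \<le> bowl \<sigma> R x" "(R\<^sup>2) powr (\<sigma> / 2) \<le> bowl \<sigma> R x"
      unfolding bowl_def using \<sigma> by (auto intro!: powr_mono2)
    then show "norm x powr \<sigma> \<le> bowl \<sigma> R x" "R powr \<sigma> \<le> bowl \<sigma> R x"
      using R by (simp_all add: power2_powr_half)
  qed
  have odd_le: "u (x + t *\<^sub>R v) - u (x - t *\<^sub>R v) \<le> \<eta> / 2 * norm x powr \<sigma> + \<eta> * R powr \<sigma>"
    if t: "0 \<le> t" "t \<le> R" for x t
  proof -
    let ?r = "norm x + 2 * R"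
    have n: "norm (x + t *\<^sub>R v) < ?r" "norm (x - t *\<^sub>R v) < ?r"
      using norm_triangle_ineq[of x "t *\<^sub>R v"] norm_triangle_ineq4[of x "t *\<^sub>R v"] v t R by auto
    have "R \<le> ?r" using R norm_ge_zero[of x] by linarith
    with growth n have "\<bar>u (x + t *\<^sub>R v)\<bar> \<le> \<eta> / 4 * ?r powr \<sigma>" "\<bar>u (x - t *\<^sub>R v)\<bar> \<le> \<eta> / 4 * ?r powr \<sigma>"
      by blast+
    then have "u (x + t *\<^sub>R v) - u (x - t *\<^sub>R v) \<le> \<eta> / 2 * ?r powr \<sigma>" by linarith
    also have "?r powr \<sigma> \<le> norm x powr \<sigma> + (2 * R) powr \<sigma>"
      using \<sigma> R by (intro powr_add_le) auto
    also have "(2 * R) powr \<sigma> \<le> 2 * R powr \<sigma>"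
      using \<sigma> R powr_mono[of \<sigma> 1 2] by (simp add: powr_mult)
    finally show ?thesis using \<eta> by (simp add: algebra_simps)
  qed
  \<comment> \<open>the odd part is at most half of \<open>\<eta> * norm x powr \<sigma>\<close> plus a constant, so \<open>F\<close> is positive only on this ball\<close>
  define \<rho> where "\<rho> = (4 * R powr \<sigma>) powr (1 / \<sigma>)"
  have small: "norm x \<le> \<rho>" if pos: "0 < F (x, t)" and t: "0 \<le> t" "t \<le> R" for x t
  proof -
    have "t\<^sup>2 / R \<le> 2 * t" using t R by (simp add: field_simps power2_eq_square mult_mono)
    then have "0 \<le> K * (2 * t - t\<^sup>2 / R)" using K by simp
    then have "norm x powr \<sigma> - R powr \<sigma> \<le> bowl \<sigma> R x - R powr \<sigma> + K * (2 * t - t\<^sup>2 / R)"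
      using bowl_ge(1)[of x] by linarith
    then have "\<eta> * (norm x powr \<sigma> - R powr \<sigma>) \<le> \<eta> * (bowl \<sigma> R x - R powr \<sigma> + K * (2 * t - t\<^sup>2 / R))"
      using \<eta> by simp
    with pos odd_le[OF t, of x] have "\<eta> * norm x powr \<sigma> < \<eta> * (4 * R powr \<sigma>)"
      by (simp add: F_def algebra_simps)
    then have "norm x powr \<sigma> \<le> 4 * R powr \<sigma>" using \<eta> by simp
    then have "(norm x powr \<sigma>) powr (1 / \<sigma>) \<le> \<rho>"
      unfolding \<rho>_def using \<sigma> by (intro powr_mono2) auto
    then show ?thesis using \<sigma> by (simp add: powr_powr)
  qed
  let ?S = "cball (0::'a) \<rho> \<times> {0..R}"
  have contF: "continuous_on ?S F"
  proof -
    have "(norm x)\<^sup>2 + R\<^sup>2 \<noteq> 0" for x :: 'a using R by (simp add: add_nonneg_eq_0_iff)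
    then show ?thesis
      unfolding F_def bowl_def
      by (intro continuous_intros continuous_on_compose2[OF u]) (use R in auto)
  qed
  have F0: "0 < F (x0, t0)" using above by (simp add: F_def)
  then have in0: "(x0, t0) \<in> ?S" using small[OF F0 t0] t0 by simp
  obtain z where z: "z \<in> ?S" "\<And>z'. z' \<in> ?S \<Longrightarrow> F z' \<le> F z"
    using continuous_attains_sup[OF _ _ contF] in0 by (metis compact_Icc compact_Times compact_cball empty_iff)
  obtain x t where xt: "z = (x, t)" by (cases z)
  have t: "0 \<le> t" "t \<le> R" using z xt by auto
  have Fpos: "0 < F (x, t)" using z(2)[OF in0] F0 xt by simp
  have max: "F (x', t') \<le> F (x, t)" if "0 \<le> t'" "t' \<le> R" for x' t'
  proof (cases "0 < F (x', t')")
    case True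
    then show ?thesis using z(2)[of "(x', t')"] small[OF True that] that xt by simp
  qed (use Fpos in simp)
  have "t \<noteq> 0"
    using Fpos bowl_ge(2)[of x] \<eta> by (auto simp: F_def zero_less_mult_iff mult_less_0_iff)
  have "t \<noteq> R"
  proof
    assume "t = R"
    have "2 * R \<le> K * R" using K R by (intro mult_right_mono) auto
    then have "norm x powr \<sigma> + R powr \<sigma> \<le> bowl \<sigma> R x - R powr \<sigma> + K * R"
      using bowl_ge(1)[of x] Rs by linarith
    then have "\<eta> * (norm x powr \<sigma> + R powr \<sigma>) \<le> \<eta> * (bowl \<sigma> R x - R powr \<sigma> + K * (2 * t - t\<^sup>2 / R))"
      using \<eta> R \<open>t = R\<close> by (simp add: power2_eq_square)
    moreover have "\<eta> / 2 * norm x powr \<sigma> \<le> \<eta> * norm x powr \<sigma>" using \<eta> by simp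
    ultimately show False
      using Fpos odd_le[OF t, of x] by (simp add: F_def algebra_simps)
  qed
  with \<open>t \<noteq> 0\<close> t have t: "0 < t" "t < R" by auto
  show thesis
  proof (rule that)
    fix y
    have "F (x + y, t) + F (x - y, t) \<le> 2 * F (x, t)"
      using max[of t "x + y"] max[of t "x - y"] t by simp
    then have "second_diff u (x + t *\<^sub>R v) y - second_diff u (x - t *\<^sub>R v) y
        \<le> \<eta> * (bowl \<sigma> R (x + y) + bowl \<sigma> R (x - y) - 2 * bowl \<sigma> R x)"
      by (simp add: F_def second_diff_def algebra_simps)
    also have "\<dots> \<le> \<eta> * (2 * bowl_modulus \<sigma> R (norm y))"
      using \<eta> R \<sigma> by (intro mult_left_mono bowl_second_difference_le) auto
    finally show "second_diff u (x + t *\<^sub>R v) y - second_diff u (x - t *\<^sub>R v) y \<le> 2 * \<eta> * bowl_modulus \<sigma> R (norm y)"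
      by simp
  next
    have "\<forall>\<^sub>F r in at_right 0. 0 < r \<and> r < min t (R - t)"
      using t by (intro eventually_conj eventually_at_right_less eventually_at_right_real) 
        (auto simp: eventually_at_right_field intro!: exI[of _ "min t (R - t)"])
    then show "\<forall>\<^sub>F r in at_right 0. second_diff u (x + t *\<^sub>R v) (r *\<^sub>R v) - second_diff u (x - t *\<^sub>R v) (r *\<^sub>R v)
        \<le> - (2 * \<eta> * K / R) * r\<^sup>2"
    proof eventually_elim
      case (elim r)
      have "F (x, t + r) + F (x, t - r) \<le> 2 * F (x, t)"
        using max[of "t + r" x] max[of "t - r" x] elim by simp
      then have "second_diff u (x + t *\<^sub>R v) (r *\<^sub>R v) - second_diff u (x - t *\<^sub>R v) (r *\<^sub>R v)
          \<le> \<eta> * (K * ((2 * (t + r) - (t + r)\<^sup>2 / R) + (2 * (t - r) - (t - r)\<^sup>2 / R) - 2 * (2 * t - t\<^sup>2 / R)))"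
        by (simp add: F_def second_diff_def algebra_simps)
      also have "(2 * (t + r) - (t + r)\<^sup>2 / R) + (2 * (t - r) - (t - r)\<^sup>2 / R) - 2 * (2 * t - t\<^sup>2 / R) = - 2 * r\<^sup>2 / R"
        using R by (simp add: field_simps power2_eq_square)
      finally show ?case by (simp add: mult_ac)
    qed
  qed
qed

text \<open>
  Without such a maximum point the barrier bounds the odd part for every \<open>\<eta>\<close> and all large \<open>R\<close>. At a
  fixed \<open>(x, t)\<close> the barrier is \<open>\<eta>\<close> times a quantity bounded independently of \<open>R\<close>, so \<open>\<eta> \<rightarrow> 0\<close> remains.
\<close>

lemma no_increase_if_no_maximum_point:
  fixes u :: "'a::euclidean_space \<Rightarrow> real"
  assumes u: "continuous_on UNIV u" and v: "norm v = 1"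
    and \<sigma>: "0 < \<sigma>" "\<sigma> \<le> 1" and K: "2 \<le> K"
    and growth: "\<And>\<epsilon>. 0 < \<epsilon> \<Longrightarrow> \<exists>R0. \<forall>R\<ge>R0. \<forall>z. norm z < R \<longrightarrow> \<bar>u z\<bar> \<le> \<epsilon> * R powr \<sigma>"
    and no_max: "\<And>\<eta> R x t. \<lbrakk>0 < \<eta>; 1 \<le> R;
      \<And>y. second_diff u (x + t *\<^sub>R v) y - second_diff u (x - t *\<^sub>R v) y \<le> 2 * \<eta> * bowl_modulus \<sigma> R (norm y);
      \<forall>\<^sub>F r in at_right 0. second_diff u (x + t *\<^sub>R v) (r *\<^sub>R v) - second_diff u (x - t *\<^sub>R v) (r *\<^sub>R v)
        \<le> - (2 * \<eta> * K / R) * r\<^sup>2\<rbrakk> \<Longrightarrow> False"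
    and t: "0 \<le> t"
  shows "u (x + t *\<^sub>R v) \<le> u (x - t *\<^sub>R v)"
proof -
  define Z where "Z = norm x powr \<sigma> + 2 * K * t + 1"
  have Z: "0 < Z" using K t by (simp add: Z_def add_nonneg_pos)
  have le: "u (x + t *\<^sub>R v) - u (x - t *\<^sub>R v) \<le> \<eta> * Z" if \<eta>: "0 < \<eta>" for \<eta>
  proof -
    obtain R0 where R0: "\<And>R z. R0 \<le> R \<Longrightarrow> norm z < R \<Longrightarrow> \<bar>u z\<bar> \<le> \<eta> / 4 * R powr \<sigma>"
      using growth[of "\<eta> / 4"] \<eta> by auto
    define R where "R = max 1 (max R0 t)"
    have R: "1 \<le> R" "R0 \<le> R" "t \<le> R" by (auto simp: R_def)
    have "u (x + t *\<^sub>R v) - u (x - t *\<^sub>R v) \<le> \<eta> * (bowl \<sigma> R x - R powr \<sigma> + K * (2 * t - t\<^sup>2 / R))"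
    proof (rule ccontr)
      assume "\<not> ?thesis"
      then have above: "\<eta> * (bowl \<sigma> R x - R powr \<sigma> + K * (2 * t - t\<^sup>2 / R)) < u (x + t *\<^sub>R v) - u (x - t *\<^sub>R v)"
        by simp
      have growth_R: "\<bar>u z\<bar> \<le> \<eta> / 4 * r powr \<sigma>" if "R \<le> r" "norm z < r" for r z
        using R0 R(2) that order_trans by blast
      obtain x' t' where
        "\<And>y. second_diff u (x' + t' *\<^sub>R v) y - second_diff u (x' - t' *\<^sub>R v) y \<le> 2 * \<eta> * bowl_modulus \<sigma> R (norm y)"
        "\<forall>\<^sub>F r in at_right 0. second_diff u (x' + t' *\<^sub>R v) (r *\<^sub>R v) - second_diff u (x' - t' *\<^sub>R v) (r *\<^sub>R v)
          \<le> - (2 * \<eta> * K / R) * r\<^sup>2"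
        using doubled_maximum_point[OF u v \<sigma> \<eta> R(1) K growth_R t R(3) above] by blast
      then show False by (rule no_max[OF \<eta> R(1), of x' t'])
    qed
    also have "\<dots> \<le> \<eta> * Z"
    proof (rule mult_left_mono)
      have "bowl \<sigma> R x - (R\<^sup>2) powr (\<sigma> / 2) \<le> bowl_modulus \<sigma> R (norm x)"
        using powr_increment_le_bowl_modulus[of \<sigma> R "norm x" "R\<^sup>2"] \<sigma> R by (simp add: bowl_def add.commute)
      then have "bowl \<sigma> R x - R powr \<sigma> \<le> norm x powr \<sigma>"
        using R power2_powr_half[of R \<sigma>] by (simp add: bowl_modulus_def)
      moreover have "K * (2 * t - t\<^sup>2 / R) \<le> K * (2 * t)"
        using K R by (intro mult_left_mono) auto
      ultimately show "bowl \<sigma> R x - R powr \<sigma> + K * (2 * t - t\<^sup>2 / R) \<le> Z"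
        by (simp add: Z_def)
    qed (use \<eta> in simp)
    finally show ?thesis .
  qed
  have "u (x + t *\<^sub>R v) \<le> u (x - t *\<^sub>R v) + \<epsilon>" if "0 < \<epsilon>" for \<epsilon>
    using le[of "\<epsilon> / Z"] Z that by simp
  then show ?thesis by (rule field_le_epsilon)
qed

section \<open>The operator at the maximum point\<close>

text \<open>
  For every block the operator, compared at the two points, is bounded below by a multiple of
  \<open>\<eta> / R\<close>, whatever its order. In the local case the decay rate is \<open>R powr (\<sigma> - 2) \<le> 1 / R\<close>.
\<close>

lemma laplacian_difference_ge:
  fixes e :: "nat \<Rightarrow> real ^ 'n" and u :: "real ^ 'n \<Rightarrow> real"
  assumes unit: "\<And>j. j \<in> {block_end N (i - 1) + 1..block_end N i} \<Longrightarrow> norm (e j) = 1"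
    and R: "1 \<le> R" and \<sigma>: "\<sigma> \<le> 1" and \<eta>: "0 < \<eta>"
    and P: "frac_lap_defined e N i 1 u P" and Q: "frac_lap_defined e N i 1 u Q"
    and le: "\<And>y. second_diff u P y - second_diff u Q y \<le> 2 * \<eta> * bowl_modulus \<sigma> R (norm y)"
  shows "- (\<eta> * (2 * real (card {block_end N (i - 1) + 1..block_end N i})) / R) \<le> frac_lap e N i 1 u P - frac_lap e N i 1 u Q"
proof -
  let ?J = "{block_end N (i - 1) + 1..block_end N i}"
  have "R powr (\<sigma> - 2) \<le> R powr (- 1)" using R \<sigma> by (intro powr_mono) auto
  then have Rp: "R powr (\<sigma> - 2) \<le> 1 / R" using R by (simp add: powr_minus_divide)
  have j: "partial (e j) (partial (e j) u) P - partial (e j) (partial (e j) u) Q \<le> 2 * \<eta> / R" if "j \<in> ?J" for j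
  proof (rule partial2_difference_le)
    show "has_partial2 (e j) u P" "has_partial2 (e j) u Q"
      using P Q that by (auto simp: frac_lap_defined_def)
    have "second_diff u P (r *\<^sub>R e j) - second_diff u Q (r *\<^sub>R e j) \<le> 2 * \<eta> / R * r\<^sup>2" for r
    proof -
      have "bowl_modulus \<sigma> R (norm (r *\<^sub>R e j)) \<le> R powr (\<sigma> - 2) * r\<^sup>2"
        using unit[OF that] by (simp add: bowl_modulus_def)
      also have "\<dots> \<le> 1 / R * r\<^sup>2" by (intro mult_right_mono Rp) auto
      finally have "2 * \<eta> * bowl_modulus \<sigma> R (norm (r *\<^sub>R e j)) \<le> 2 * \<eta> * (1 / R * r\<^sup>2)"
        using \<eta> by (intro mult_left_mono) auto
      with le[of "r *\<^sub>R e j"] show ?thesis by simp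
    qed
    then show "\<forall>\<^sub>F t in at_right 0. (u (P + t *\<^sub>R e j) + u (P - t *\<^sub>R e j) - 2 * u P)
        - (u (Q + t *\<^sub>R e j) + u (Q - t *\<^sub>R e j) - 2 * u Q) \<le> 2 * \<eta> / R * t\<^sup>2"
      by (simp add: second_diff_def)
  qed
  have "(\<Sum>j\<in>?J. partial (e j) (partial (e j) u) P - partial (e j) (partial (e j) u) Q) \<le> real (card ?J) * (2 * \<eta> / R)"
    by (rule sum_bounded_above) (rule j)
  then show ?thesis by (simp add: frac_lap_def sum_subtractf algebra_simps del: card_atLeastAtMost)
qed

text \<open>
  The integrands at the two points differ by at most the bowl modulus over the kernel, whose integral
  is of order \<open>R powr (\<sigma> - 2 * s)\<close>. The growth exponent is tied to the orders exactly so that this is at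
  most \<open>1 / R\<close>. The bounding function has to be integrable, since the total
  Bochner integral would otherwise be \<open>0\<close> and monotonicity would fail.
\<close>

lemma fractional_laplacian_difference_ge:
  fixes e :: "nat \<Rightarrow> real ^ 'n"
  assumes inj: "inj_on e {1..CARD('n)}" and e: "e ` {1..CARD('n)} \<subseteq> Basis"
    and i: "1 \<le> i" and block: "block_end N i \<le> CARD('n)"
    and s: "0 < s" "s < 1" and \<sigma>: "\<sigma> \<le> 2 * s - 1"
  obtains C where "0 \<le> C"
    "\<And>\<eta> R u P Q. \<lbrakk>0 < \<eta>; 1 \<le> R; frac_lap_defined e N i s u P; frac_lap_defined e N i s u Q;
      \<And>y. second_diff u P y - second_diff u Q y \<le> 2 * \<eta> * bowl_modulus \<sigma> R (norm y)\<rbrakk>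
      \<Longrightarrow> - (\<eta> * C / R) \<le> frac_lap e N i s u P - frac_lap e N i s u Q"
proof -
  let ?M = "Pi\<^sub>M {1..N i} (\<lambda>_. lborel :: real measure)"
  let ?b = "block_vec e N i"
  define D where "D = 2 ^ N i * 2 ^ N i * (1 / (1 - 2 powr (2 * s - 2)) + 1 / (1 - 2 powr (\<sigma> - 2 * s)))"
  define C where "C = frac_const (N i) s * (2 * D)"
  have "(2::real) powr z \<le> 1" if "z < 0" for z
    using powr_less_mono[of z 0 2] that by simp
  then have D: "0 \<le> D" using s \<sigma> unfolding D_def by (intro mult_nonneg_nonneg add_nonneg_nonneg) auto
  have c: "0 \<le> frac_const (N i) s"
    unfolding frac_const_def using s by (intro divide_nonneg_nonneg mult_nonneg_nonneg) (auto intro!: less_imp_le Gamma_real_pos)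
  have meas [measurable]: "(\<lambda>y. norm (?b y)) \<in> borel_measurable ?M"
    unfolding block_vec_def by measurable
  show thesis
  proof (rule that)
    show "0 \<le> C" using c D by (simp add: C_def)
    fix \<eta> R u P Q
    assume \<eta>: "0 < \<eta>" and R: "(1::real) \<le> R"
      and P: "frac_lap_defined e N i s u P" and Q: "frac_lap_defined e N i s u Q"
      and le: "\<And>y. second_diff u P y - second_diff u Q y \<le> 2 * \<eta> * bowl_modulus \<sigma> R (norm y)"
    define G where "G y = bowl_modulus \<sigma> R (norm (?b y)) / norm (?b y) powr (N i + 2 * s)" for y
    have G0: "0 \<le> G y" for y by (simp add: G_def bowl_modulus_def)
    have G_meas: "G \<in> borel_measurable ?M" unfolding G_def bowl_modulus_def by measurable
    have "(\<integral>\<^sup>+ y. ennreal (G y) \<partial>?M) \<le> ennreal (D * R powr (\<sigma> - 2 * s))"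
      unfolding G_def D_def
      by (rule nn_integral_bowl_modulus_le[OF meas emeasure_norm_block_vec_le[OF inj e i block]])
        (use s \<sigma> R in auto)
    also have "\<dots> \<le> ennreal (D / R)"
    proof -
      have "R powr (\<sigma> - 2 * s) \<le> R powr (- 1)" using R \<sigma> by (intro powr_mono) auto
      then have "R powr (\<sigma> - 2 * s) \<le> 1 / R" using R by (simp add: powr_minus_divide)
      then have "D * R powr (\<sigma> - 2 * s) \<le> D * (1 / R)" by (intro mult_left_mono D)
      then show ?thesis by (simp add: ennreal_leI)
    qed
    finally have nn: "(\<integral>\<^sup>+ y. ennreal (G y) \<partial>?M) \<le> ennreal (D / R)" .
    have intG: "integrable ?M G"
      using le_less_trans[OF nn ennreal_less_top] G0 by (intro integrableI_bounded G_meas) simp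
    have "ennreal (\<integral>y. G y \<partial>?M) \<le> ennreal (D / R)"
      using nn nn_integral_eq_integral[OF intG] G0 by simp
    then have IG: "(\<integral>y. G y \<partial>?M) \<le> D / R" using D R by (simp add: ennreal_le_iff)
    have iP: "integrable ?M (frac_integrand e N i s u P)" and iQ: "integrable ?M (frac_integrand e N i s u Q)"
      using P Q s by (auto simp: frac_lap_defined_def)
    have "(\<integral>y. frac_integrand e N i s u Q y - frac_integrand e N i s u P y \<partial>?M) \<le> (\<integral>y. 2 * \<eta> * G y \<partial>?M)"
    proof (rule integral_mono)
      fix y
      have "frac_integrand e N i s u Q y - frac_integrand e N i s u P y
          = (second_diff u P (?b y) - second_diff u Q (?b y)) / norm (?b y) powr (N i + 2 * s)"
        by (simp add: frac_integrand_def second_diff_def flip: diff_divide_distrib)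
      also have "\<dots> \<le> (2 * \<eta> * bowl_modulus \<sigma> R (norm (?b y))) / norm (?b y) powr (N i + 2 * s)"
        by (intro divide_right_mono le) auto
      finally show "frac_integrand e N i s u Q y - frac_integrand e N i s u P y \<le> 2 * \<eta> * G y"
        by (simp add: G_def)
    qed (use iP iQ intG in auto)
    also have "\<dots> = 2 * \<eta> * (\<integral>y. G y \<partial>?M)" by simp
    also have "\<dots> \<le> 2 * \<eta> * (D / R)" using IG \<eta> by (intro mult_left_mono) auto
    also have "(\<integral>y. frac_integrand e N i s u Q y - frac_integrand e N i s u P y \<partial>?M)
        = (\<integral>y. frac_integrand e N i s u Q y \<partial>?M) - (\<integral>y. frac_integrand e N i s u P y \<partial>?M)"
      by (rule Bochner_Integration.integral_diff) fact+
    finally have "frac_const (N i) s * ((\<integral>y. frac_integrand e N i s u Q y \<partial>?M) - (\<integral>y. frac_integrand e N i s u P y \<partial>?M))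
        \<le> frac_const (N i) s * (2 * \<eta> * (D / R))"
      by (rule mult_left_mono) (rule c)
    then show "- (\<eta> * C / R) \<le> frac_lap e N i s u P - frac_lap e N i s u Q"
      using s by (simp add: frac_lap_def C_def algebra_simps)
  qed
qed

lemma block_difference_ge:
  fixes e :: "nat \<Rightarrow> real ^ 'n"
  assumes inj: "inj_on e {1..CARD('n)}" and e: "e ` {1..CARD('n)} \<subseteq> Basis"
    and i: "1 \<le> i" and block: "block_end N i \<le> CARD('n)"
    and s: "0 < s" "s \<le> 1" and \<sigma>: "\<sigma> \<le> 2 * s - 1"
  shows "\<exists>C\<ge>0. \<forall>\<eta> R u P Q. 0 < \<eta> \<longrightarrow> 1 \<le> R \<longrightarrow> frac_lap_defined e N i s u P \<longrightarrow> frac_lap_defined e N i s u Q \<longrightarrow>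
      (\<forall>y. second_diff u P y - second_diff u Q y \<le> 2 * \<eta> * bowl_modulus \<sigma> R (norm y)) \<longrightarrow>
      - (\<eta> * C / R) \<le> frac_lap e N i s u P - frac_lap e N i s u Q"
proof (cases "s = 1")
  case True
  have "norm (e j) = 1" if "j \<in> {block_end N (i - 1) + 1..block_end N i}" for j
    using e that block by (intro norm_Basis) (auto simp: image_subset_iff)
  then show ?thesis
    unfolding True
    by (intro exI[of _ "2 * real (card {block_end N (i - 1) + 1..block_end N i})"] conjI allI impI
        laplacian_difference_ge[where \<sigma> = \<sigma>])
      (use True \<sigma> in auto)
next
  case False
  with s have "s < 1" by simp
  from fractional_laplacian_difference_ge[OF inj e i block s(1) this \<sigma>] show ?thesis by metis
qed

section \<open>Rigidity in the last coordinate\<close>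

theorem theorem1p4:
  fixes e :: "nat \<Rightarrow> real ^ 'n" and m :: nat and N :: "nat \<Rightarrow> nat"
    and a s :: "nat \<Rightarrow> real" and \<sigma> :: real and f u :: "real ^ 'n \<Rightarrow> real"
  assumes "bij_betw e {1..CARD('n)} Basis"
    and "1 \<le> m"
    and "\<And>i. i \<in> {1..m - 1} \<Longrightarrow> 1 \<le> N i"
    and "(\<Sum>i=1..m - 1. N i) = CARD('n) - 1"
    and "N m = 1"
    and "\<And>i. i \<in> {1..m - 1} \<Longrightarrow> 0 \<le> a i"
    and "0 < a m"
    and "\<And>i. i \<in> {1..m - 1} \<Longrightarrow> 0 < s i \<and> s i \<le> 1"
    and "s m = 1"
    and "\<sigma> = 2 * Min (s ` {1..m}) - 1"
    and "0 < \<sigma>"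
    and "classical_solution e m N a s f UNIV u"
    and "indep_of_dir (e CARD('n)) f"
    and "((\<lambda>R. Linf_norm (ball 0 R) u / ereal (R powr \<sigma>)) \<longlongrightarrow> 0) at_top"
  shows "indep_of_dir (e CARD('n)) u"
proof -
  let ?n = "CARD('n)"
  have inj: "inj_on e {1..?n}" and e: "e ` {1..?n} \<subseteq> Basis"
    using assms(1) by (auto simp: bij_betw_def)
  have n1: "1 \<le> ?n" by simp
  have unit: "norm (e ?n) = 1" using e n1 by (intro norm_Basis) (auto simp: image_subset_iff)
  have min_le: "\<sigma> \<le> 2 * s i - 1" if "i \<in> {1..m}" for i
    using that assms(10) by (auto intro!: Min_le)
  have \<sigma>: "0 < \<sigma>" "\<sigma> \<le> 1" using assms(2,9,11) min_le[of m] by auto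
  have end_before_m: "block_end N (m - 1) = ?n - 1" using assms(4) by (simp add: block_end_def)
  have end_m: "block_end N m = ?n"
    using assms(2,5) end_before_m n1 by (cases m) (auto simp: block_end_def)
  have block: "block_end N i \<le> ?n" if "i \<in> {1..m - 1}" for i
  proof -
    have "block_end N i \<le> block_end N (m - 1)"
      unfolding block_end_def using that by (intro sum_mono2) auto
    then show ?thesis using end_before_m by simp
  qed
  have u: "continuous_on UNIV u"
    and defd: "\<And>x i. i \<in> {1..m} \<Longrightarrow> a i \<noteq> 0 \<Longrightarrow> frac_lap_defined e N i (s i) u x"
    and eq: "\<And>x. aniso_op e m N a s u x = f x"
    using assms(12) by (auto simp: classical_solution_def)
  have "\<forall>i\<in>{1..m - 1}. \<exists>C\<ge>0. \<forall>\<eta> R u P Q. 0 < \<eta> \<longrightarrow> 1 \<le> R \<longrightarrow> frac_lap_defined e N i (s i) u P \<longrightarrow> frac_lap_defined e N i (s i) u Q \<longrightarrow>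
      (\<forall>y. second_diff u P y - second_diff u Q y \<le> 2 * \<eta> * bowl_modulus \<sigma> R (norm y)) \<longrightarrow>
      - (\<eta> * C / R) \<le> frac_lap e N i (s i) u P - frac_lap e N i (s i) u Q"
    using assms(8) min_le by (intro ballI block_difference_ge[OF inj e] block) auto
  then obtain C where C0: "\<And>i. i \<in> {1..m - 1} \<Longrightarrow> 0 \<le> C i"
    and C: "\<And>i \<eta> R P Q. \<lbrakk>i \<in> {1..m - 1}; 0 < \<eta>; 1 \<le> R; frac_lap_defined e N i (s i) u P; frac_lap_defined e N i (s i) u Q;
      \<And>y. second_diff u P y - second_diff u Q y \<le> 2 * \<eta> * bowl_modulus \<sigma> R (norm y)\<rbrakk> \<Longrightarrow>
      - (\<eta> * C i / R) \<le> frac_lap e N i (s i) u P - frac_lap e N i (s i) u Q"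
    unfolding Bex_def[symmetric] by (metis (no_types, lifting))
  define T where "T = (\<Sum>i=1..m - 1. a i * C i)"
  have T: "0 \<le> T" unfolding T_def using assms(6) C0 by (intro sum_nonneg mult_nonneg_nonneg) auto
  \<comment> \<open>\<open>T / a m\<close> beats the first blocks in \<open>no_max\<close> below; \<open>2\<close> makes the barrier high enough at \<open>t = R\<close>\<close>
  define K where "K = 2 + T / a m"
  have K: "2 \<le> K" using T assms(7) by (simp add: K_def)
  have no_max: False
    if \<eta>: "0 < \<eta>" and R: "1 \<le> R" and v: "v = e ?n \<or> v = - e ?n"
      and le: "\<And>y. second_diff u (x + t *\<^sub>R v) y - second_diff u (x - t *\<^sub>R v) y \<le> 2 * \<eta> * bowl_modulus \<sigma> R (norm y)"
      and lev: "\<forall>\<^sub>F r in at_right 0. second_diff u (x + t *\<^sub>R v) (r *\<^sub>R v) - second_diff u (x - t *\<^sub>R v) (r *\<^sub>R v)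
        \<le> - (2 * \<eta> * K / R) * r\<^sup>2" for \<eta> R x t v
  proof -
    define P where "P = x + t *\<^sub>R v"
    define Q where "Q = x - t *\<^sub>R v"
    let ?d = "\<lambda>i. frac_lap e N i (s i) u P - frac_lap e N i (s i) u Q"
    have f_eq: "f (z + r *\<^sub>R v) = f z" for z r
      using v assms(13) unfolding indep_of_dir_def by (metis scaleR_minus_left scaleR_minus_right)
    \<comment> \<open>\<open>P\<close> and \<open>Q\<close> differ by a multiple of the last basis vector, so the equation gives \<open>L u P = L u Q\<close>\<close>
    have "f P = f Q" using f_eq[of x t] f_eq[of x "- t"] by (simp add: P_def Q_def)
    have m: "{1..m} = insert m {1..m - 1}" using assms(2) by auto
    have "0 = aniso_op e m N a s u P - aniso_op e m N a s u Q" using eq \<open>f P = f Q\<close> by simp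
    also have "\<dots> = (\<Sum>i=1..m. a i * ?d i)"
      by (simp add: aniso_op_def sum_subtractf right_diff_distrib)
    also have "\<dots> = a m * ?d m + (\<Sum>i=1..m - 1. a i * ?d i)"
      unfolding m using assms(2) by (subst sum.insert) auto
    finally have zero: "a m * ?d m + (\<Sum>i=1..m - 1. a i * ?d i) = 0" by simp
    have "(\<Sum>i=1..m - 1. a i * - (\<eta> * C i / R)) \<le> (\<Sum>i=1..m - 1. a i * ?d i)"
    proof (rule sum_mono)
      fix i assume i: "i \<in> {1..m - 1}"
      show "a i * - (\<eta> * C i / R) \<le> a i * ?d i"
      proof (cases "a i = 0")
        case False
        have "- (\<eta> * C i / R) \<le> ?d i"
          using i False le by (intro C \<eta> R defd) (auto simp: P_def Q_def)
        then show ?thesis using assms(6)[OF i] by (rule mult_left_mono)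
      qed simp
    qed
    also have "(\<Sum>i=1..m - 1. a i * - (\<eta> * C i / R)) = - (\<eta> * T / R)"
      by (simp add: T_def sum_distrib_left sum_divide_distrib sum_negf mult_ac)
    finally have rest: "- (\<eta> * T / R) \<le> (\<Sum>i=1..m - 1. a i * ?d i)" .
    have hp: "has_partial2 (e ?n) u z" for z
      using defd[of m z] assms(2,7,9) end_m end_before_m n1 by (auto simp: frac_lap_defined_def)
    have "partial (e ?n) (partial (e ?n) u) P - partial (e ?n) (partial (e ?n) u) Q \<le> - (2 * \<eta> * K / R)"
    proof (rule partial2_difference_le[OF hp hp])
      show "\<forall>\<^sub>F r in at_right 0. (u (P + r *\<^sub>R e ?n) + u (P - r *\<^sub>R e ?n) - 2 * u P)
          - (u (Q + r *\<^sub>R e ?n) + u (Q - r *\<^sub>R e ?n) - 2 * u Q) \<le> - (2 * \<eta> * K / R) * r\<^sup>2"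
        using lev unfolding P_def[symmetric] Q_def[symmetric]
        by eventually_elim (use v in \<open>auto simp: second_diff_def\<close>)
    qed
    moreover have "frac_lap e N m (s m) u z = - partial (e ?n) (partial (e ?n) u) z" for z
      using assms(9) end_m end_before_m n1 by (simp add: frac_lap_def)
    ultimately have "2 * \<eta> * K / R \<le> ?d m" by simp
    then have "a m * (2 * \<eta> * K / R) \<le> a m * ?d m" using assms(7) by (intro mult_left_mono) auto
    moreover have "a m * (2 * \<eta> * K / R) = 2 * \<eta> * (2 * a m + T) / R"
      using assms(7) R by (simp add: K_def field_simps)
    moreover have "a m * ?d m \<le> \<eta> * T / R" using zero rest by (simp only: add_eq_0_iff)
    ultimately have "2 * \<eta> * (2 * a m + T) / R \<le> \<eta> * T / R" by (simp only:)
    then have "2 * \<eta> * (2 * a m + T) \<le> \<eta> * T" using R by (simp add: divide_le_cancel)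
    then have "2 * (2 * a m + T) \<le> T" using \<eta> by (simp add: mult.assoc mult.left_commute[of 2])
    then show False using T assms(7) by simp
  qed
  have growth: "\<exists>R0. \<forall>R\<ge>R0. \<forall>z. norm z < R \<longrightarrow> \<bar>u z\<bar> \<le> \<epsilon> * R powr \<sigma>" if "0 < \<epsilon>" for \<epsilon>
    using Linf_growth_pointwise[OF u that assms(14)] by metis
  \<comment> \<open>the two signs of \<open>v\<close> give both inequalities between \<open>u (x + t e)\<close> and \<open>u (x - t e)\<close>\<close>
  have no_increase: "u (x + t *\<^sub>R v) \<le> u (x - t *\<^sub>R v)" if "0 \<le> t" "v = e ?n \<or> v = - e ?n" for x t v
  proof -
    have "norm v = 1" using that unit by auto
    then show ?thesis
    proof (rule no_increase_if_no_maximum_point[OF u _ \<sigma> K growth _ that(1)])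
      fix \<eta> R y r
      assume "0 < \<eta>" "1 \<le> R"
        "\<And>z. second_diff u (y + r *\<^sub>R v) z - second_diff u (y - r *\<^sub>R v) z \<le> 2 * \<eta> * bowl_modulus \<sigma> R (norm z)"
        "\<forall>\<^sub>F h in at_right 0. second_diff u (y + r *\<^sub>R v) (h *\<^sub>R v) - second_diff u (y - r *\<^sub>R v) (h *\<^sub>R v)
          \<le> - (2 * \<eta> * K / R) * h\<^sup>2"
      then show False by (rule no_max[OF _ _ that(2)])
    qed
  qed
  have even: "u (x + t *\<^sub>R e ?n) = u (x - t *\<^sub>R e ?n)" if "0 \<le> t" for x t
    using no_increase[OF that, of "e ?n" x] no_increase[OF that, of "- e ?n" x] by simp
  have sym: "u (x + t *\<^sub>R e ?n) = u (x - t *\<^sub>R e ?n)" for x t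
    using even[of t x] even[of "- t" x] by (cases "0 \<le> t") auto
  show ?thesis
    unfolding indep_of_dir_def
  proof (intro allI)
    fix x t
    have "x + (t / 2) *\<^sub>R e ?n + (t / 2) *\<^sub>R e ?n = x + t *\<^sub>R e ?n"
      by (simp only: add.assoc flip: scaleR_add_left) simp
    with sym[of "x + (t / 2) *\<^sub>R e ?n" "t / 2"] show "u (x + t *\<^sub>R e ?n) = u x"
      by (simp only: add_diff_cancel_right')
  qed
qed

end
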